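(* Let $d\ge 2$, let $n_1,\dots,n_d$ be positive integers and let $k_i\ge 0$, $s_i\ge 0$ ($i=1,\dots,d-1$) be integers. Let $A\in\mathcal{M}_{=(k_{1},\dots,k_{d-1})}^{n_{1}\times\dots\times n_{d}}$ and let $A_{1}\in\mathbb{R}^{n_{1}\times k_{1}}$, $A_{i}\in\mathbb{R}^{k_{i-1}\times n_{i}\times k_{i}}$ ($i=2,\dots,d-1$), $A_{d}\in\mathbb{R}^{k_{d-1}\times n_{d}}$ be such that $A=A_{1}A_2\cdots A_{d}$. If $\mathcal{X}\in\mathbb{R}^{n_1\times\dots\times n_d}$ can be factorized as $$\mathcal{X}=\begin{pmatrix} A_{1} & U_{1} & X_{1} \end{pmatrix}\begin{pmatrix} A_{2} & U_{2} & X_{2} \\ 0 & Z_{2} & V_{2} \\ 0 & 0 & A_{2} \end{pmatrix}\cdots\begin{pmatrix} A_{d-1} & U_{d-1} & X_{d-1} \\ 0 & Z_{d-1} & V_{d-1} \\ 0 & 0 & A_{d-1} \end{pmatrix}\begin{pmatrix} X_{d} \\ V_{d} \\ A_{d} \end{pmatrix}$$ with some tensors $U_1\in\mathbb{R}^{n_1\times s_1}$, $X_1\in\mathbb{R}^{n_1\times k_1}$; $U_i\in\mathbb{R}^{k_{i-1}\times n_i\times s_i}$, $X_i\in\mathbb{R}^{k_{i-1}\times n_i\times k_i}$, $Z_i\in\mathbb{R}^{s_{i-1}\times n_i\times s_i}$, $V_i\in\mathbb{R}^{s_{i-1}\times n_i\times k_i}$ ($2\le i\le d-1$); $X_d\in\mathbb{R}^{k_{d-1}\times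 n_d}$, $V_d\in\mathbb{R}^{s_{d-1}\times n_d}$, then $\mathcal{X}$ lies in the tangent cone $T_A\mathcal{M}_{\leq(k_{1}+s_{1},\dots,k_{d-1}+s_{d-1})}^{n_{1}\times\dots\times n_{d}}$ at $A=A_1\cdots A_d$.
   Context: Tensors are elements of $\mathbb{R}^{m_1\times\dots\times m_r}$. $A^{(n_1\dots n_i)\times(n_{i+1}\dots n_d)}$ denotes the matricization of $A\in\mathbb{R}^{n_1\times\dots\times n_d}$ obtained by grouping the first $i$ indices as row index and the remaining ones as column index (lexicographic order). TT product: for $A\in\mathbb{R}^{n_1\times\dots\times n_i\times k}$ and $B\in\mathbb{R}^{k\times n_{i+1}\times\dots\times n_d}$, $AB\in\mathbb{R}^{n_1\times\dots\times n_d}$ has entries $(AB)(j_1,\dots,j_d)=\sum_{m=1}^kA(j_1,\dots,j_i,m)B(m,j_{i+1},\dots,j_d)$; it is associative. A block matrix whose blocks are order 3 tensors denotes the order 3 tensor obtained by placing the blocks along the first index (block rows) and last index (block columns), the middle index being shared; i.e. for each fixed middle index it is the corresponding block matrix. TT variety and TT manifold: $\mathcal{M}_{\leq(r_{1},\dots,r_{d-1})}^{n_{1}\times\dots\times n_{d}}=\{A\in\mathbb{R}^{n_{1}\times\dots\times n_{d}}:\forall i:\operatorname{rank}(A^{(n_{1}\dots n_{i})\times(n_{i+1}\dots n_{d})})\leq r_{i}\}$, and $\mathcal{M}_{=(r_{1},\dots,r_{d-1})}^{n_{1}\times\dots\times n_{d}}$ is defined by the same condition with $=$ in place of $\le$.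 Tangent cone (Bouligand contingent cone) of $\mathcal{M}\subset\mathbb{R}^N$ at $A\in\mathcal{M}$: $T_{A}\mathcal{M}=\{\xi\in\mathbb{R}^{N}:\exists(x_{n})\subset\mathcal{M},(a_{n})\subset\mathbb{R}^{+}\text{ s.t. }x_{n}\rightarrow A,\ a_{n}(x_{n}-A)\rightarrow\xi\}$. *)

theory Defs
  imports "HOL-Analysis.Function_Topology" "Jordan_Normal_Form.DL_Rank"
begin

text \<open>
  A tensor of shape \<open>ns = [n\<^sub>1, \<dots>, n\<^sub>d]\<close> is a function on index lists \<open>[j\<^sub>1, \<dots>, j\<^sub>d]\<close> with
  \<open>j\<^sub>i < n\<^sub>i\<close> (indices start at 0), extended by 0 to all other lists. The order is the length of
  the shape, so it can vary inside a statement.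
\<close>

type_synonym tensor = "nat list \<Rightarrow> real"

text \<open>\<open>product_lists\<close> enumerates the index lists of a shape in lexicographic order.\<close>

definition tensor_indices :: "nat list \<Rightarrow> nat list list" where
  "tensor_indices ns = product_lists (map (\<lambda>n. [0..<n]) ns)"

definition tensors :: "nat list \<Rightarrow> tensor set" where
  "tensors ns = {A. \<forall>js. js \<notin> set (tensor_indices ns) \<longrightarrow> A js = 0}"

definition matricization :: "nat list \<Rightarrow> nat \<Rightarrow> tensor \<Rightarrow> real mat" where
  "matricization ns i A =
     (let R = tensor_indices (take i ns); C = tensor_indices (drop i ns)
      in mat (length R) (length C) (\<lambda>(a, b). A (R ! a @ C ! b)))"

definition mat_rank :: "real mat \<Rightarrow> nat" where
  "mat_rank M = vec_space.rank (dim_row M) M"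

definition TT_variety :: "nat list \<Rightarrow> (nat \<Rightarrow> nat) \<Rightarrow> tensor set" where
  "TT_variety ns r =
     {A \<in> tensors ns. \<forall>i\<in>{1..<length ns}. mat_rank (matricization ns i A) \<le> r i}"

definition TT_manifold :: "nat list \<Rightarrow> (nat \<Rightarrow> nat) \<Rightarrow> tensor set" where
  "TT_manifold ns r =
     {A \<in> tensors ns. \<forall>i\<in>{1..<length ns}. mat_rank (matricization ns i A) = r i}"

text \<open>
  The TT product of a tensor \<open>A\<close> with \<open>p\<close> indices before its last index and a tensor \<open>B\<close>, where
  the last index of \<open>A\<close> and the first index of \<open>B\<close> both range over \<open>{..<k}\<close>.
\<close>

definition tt_mult :: "nat \<Rightarrow> nat \<Rightarrow> tensor \<Rightarrow> tensor \<Rightarrow> tensor" where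
  "tt_mult p k A B = (\<lambda>js. \<Sum>m<k. A (take p js @ [m]) * B (m # drop p js))"

text \<open>
  The product \<open>G\<^sub>1 G\<^sub>2 \<cdots> G\<^sub>d\<close>, bracketed to the left, where \<open>r i\<close> is the size of the index shared by
  \<open>G i\<close> and \<open>G (i + 1)\<close>.
\<close>

definition tt_prod :: "nat \<Rightarrow> (nat \<Rightarrow> nat) \<Rightarrow> (nat \<Rightarrow> tensor) \<Rightarrow> tensor" where
  "tt_prod d r G = fold (\<lambda>i P. tt_mult i (r i) P (G (Suc i))) [1..<d] (G 1)"

text \<open>
  For a position \<open>a\<close> in an index range split into consecutive blocks of the given sizes:
  the number of the block containing \<open>a\<close> and the offset of \<open>a\<close> in that block.
\<close>

fun locate :: "nat list \<Rightarrow> nat \<Rightarrow> nat \<times> nat" where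
  "locate [] a = (0, a)"
| "locate (b # bs) a =
     (if a < b then (0, a) else (let (p, a') = locate bs (a - b) in (Suc p, a')))"

text \<open>
  Block tensors with block sizes \<open>rs\<close> along the first index and \<open>cs\<close> along the last index;
  \<open>Bs ! p ! q\<close> is the block in block row \<open>p\<close> and block column \<open>q\<close>. The versions \<open>block_row\<close> and
  \<open>block_col\<close> produce the matrices at the two ends, where the first or the last index is absent.
\<close>

definition block_tensor :: "nat list \<Rightarrow> nat list \<Rightarrow> tensor list list \<Rightarrow> tensor" where
  "block_tensor rs cs Bs = (\<lambda>js. case js of
       [a, j, b] \<Rightarrow>
         if a < sum_list rs \<and> b < sum_list cs
         then (let (p, a') = locate rs a; (q, b') = locate cs b in (Bs ! p ! q) [a', j, b'])
         else 0
     | _ \<Rightarrow> 0)"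

definition block_row :: "nat list \<Rightarrow> tensor list \<Rightarrow> tensor" where
  "block_row cs Bs = (\<lambda>js. case js of
       [j, b] \<Rightarrow>
         if b < sum_list cs then (let (q, b') = locate cs b in (Bs ! q) [j, b']) else 0
     | _ \<Rightarrow> 0)"

definition block_col :: "nat list \<Rightarrow> tensor list \<Rightarrow> tensor" where
  "block_col rs Bs = (\<lambda>js. case js of
       [a, j] \<Rightarrow>
         if a < sum_list rs then (let (p, a') = locate rs a in (Bs ! p) [a', j]) else 0
     | _ \<Rightarrow> 0)"

definition zero_tensor :: tensor where
  "zero_tensor = (\<lambda>_. 0)"

text \<open>
  The limits are taken in the product topology of the function space, that is, entrywise. On the
  finite-dimensional space \<open>tensors ns\<close> this is the Euclidean topology, and \<open>tensors ns\<close> is closed,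
  so for \<open>M \<subseteq> tensors ns\<close> the cone is the contingent cone in \<open>tensors ns\<close>.
\<close>

definition tangent_cone :: "('i \<Rightarrow> real) set \<Rightarrow> ('i \<Rightarrow> real) \<Rightarrow> ('i \<Rightarrow> real) set" where
  "tangent_cone M A =
     {\<xi>. \<exists>(x :: nat \<Rightarrow> 'i \<Rightarrow> real) (a :: nat \<Rightarrow> real).
           (\<forall>m. x m \<in> M) \<and> (\<forall>m. 0 < a m) \<and> x \<longlonglongrightarrow> A \<and>
           (\<lambda>m j. a m * (x m j - A j)) \<longlonglongrightarrow> \<xi>}"

end

theory Submission
  imports Defs
begin

text \<open>
  The curve \<open>x(t)\<close> with first core \<open>(A\<^sub>1 + t X\<^sub>1, U\<^sub>1)\<close>, inner cores with block rows
  \<open>(A\<^sub>i + t X\<^sub>i, U\<^sub>i)\<close> and \<open>(t V\<^sub>i, Z\<^sub>i)\<close>, and last core with block rows \<open>A\<^sub>d + t X\<^sub>d\<close> and \<open>t V\<^sub>d\<close>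
  has TT ranks at most \<open>k\<^sub>i + s\<^sub>i\<close>. Every excursion through the second block costs one factor \<open>t\<close>
  (paid at the block \<open>t V\<close> that ends it), so \<open>x(0) = A\<^sub>1 \<cdots> A\<^sub>d\<close>, and the linear
  coefficient of \<open>x\<close> collects the products with exactly one factor \<open>X\<^sub>i\<close> or exactly one excursion
  \<open>U Z \<cdots> Z V\<close>. The product of the given 3 by 3 block cores is that sum.
\<close>

section \<open>Tensor shapes and TT products\<close>

lemma in_tensor_indices_iff:
  "js \<in> set (tensor_indices ns) \<longleftrightarrow> list_all2 (<) js ns"
  by (simp add: tensor_indices_def product_lists_set list_all2_map2)

lemma tensorsD: "A \<in> tensors ns \<Longrightarrow> \<not> list_all2 (<) js ns \<Longrightarrow> A js = 0"
  by (simp add: tensors_def in_tensor_indices_iff)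

lemma tensorsI: "(\<And>js. \<not> list_all2 (<) js ns \<Longrightarrow> A js = 0) \<Longrightarrow> A \<in> tensors ns"
  by (simp add: tensors_def in_tensor_indices_iff)

lemma tensors_lincomb:
  assumes "A \<in> tensors ns" "B \<in> tensors ns"
  shows "(\<lambda>js. A js + t * B js) \<in> tensors ns"
  using assms by (simp add: tensors_def)

lemma tensors_scale:
  assumes "A \<in> tensors ns"
  shows "(\<lambda>js. t * A js) \<in> tensors ns"
  using assms by (simp add: tensors_def)

lemma tt_mult_in_tensors:
  assumes A: "A \<in> tensors (xs @ [k])" and B: "B \<in> tensors (k # ys)" and p: "length xs = p"
  shows "tt_mult p k A B \<in> tensors (xs @ ys)"
proof (rule tensorsI)
  fix js
  assume js: "\<not> list_all2 (<) js (xs @ ys)"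
  have "A (take p js @ [m]) * B (m # drop p js) = 0" if "m < k" for m
  proof (rule ccontr)
    assume "A (take p js @ [m]) * B (m # drop p js) \<noteq> 0"
    then have "list_all2 (<) (take p js @ [m]) (xs @ [k])" "list_all2 (<) (m # drop p js) (k # ys)"
      using tensorsD[OF A] tensorsD[OF B] by force+
    then have "list_all2 (<) (take p js) xs" "list_all2 (<) (drop p js) ys"
      by (auto simp: list_all2_append1 list_all2_Cons1 append_eq_append_conv2 Cons_eq_append_conv
          dest: list_all2_lengthD)
    then have "list_all2 (<) (take p js @ drop p js) (xs @ ys)"
      by (rule list_all2_appendI)
    then show False
      using js by simp
  qed
  then show "tt_mult p k A B js = 0"
    unfolding tt_mult_def by (intro sum.neutral) simp
qed

text \<open>Both sides are the same double sum in the two orders of summation. The identity is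
  stated entrywise because on a word shorter than \<open>i\<close> the prefix \<open>take i\<close>
  would swallow the appended summation index.\<close>

lemma tt_mult_assoc:
  assumes "i \<le> e" "i \<le> length w"
  shows "tt_mult e q (tt_mult i r P Q) G w = tt_mult i r P (tt_mult (Suc e - i) q Q G) w"
proof -
  have *: "take i (take e w @ [l]) = take i w"
    "drop i (take e w @ [l]) = take (e - i) (drop i w) @ [l]"
    "take (Suc e - i) (m # drop i w) = m # take (e - i) (drop i w)"
    "drop (Suc e - i) (m # drop i w) = drop e w" for l m
    using assms by (simp_all add: Suc_diff_le drop_take min_absorb1)
  show ?thesis
    unfolding tt_mult_def * sum_distrib_left sum_distrib_right
    by (subst sum.swap) (simp add: * mult.assoc)
qed

lemma tt_prod_1: "tt_prod (Suc 0) r G = G 1"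
  by (simp add: tt_prod_def)

lemma tt_prod_Suc: "0 < e \<Longrightarrow> tt_prod (Suc e) r G = tt_mult e (r e) (tt_prod e r G) (G (Suc e))"
  by (simp add: tt_prod_def)

lemma tt_prod_in_tensors:
  assumes "2 \<le> d"
    and "G 1 \<in> tensors [n 1, r 1]"
    and "\<And>i. i \<in> {2..<d} \<Longrightarrow> G i \<in> tensors [r (i - 1), n i, r i]"
    and "G d \<in> tensors [r (d - 1), n d]"
  shows "tt_prod d r G \<in> tensors (map n [1..<Suc d])"
proof -
  have "tt_prod (Suc e) r G \<in> tensors (map n [1..<Suc (Suc e)] @ [r (Suc e)])" if "Suc e < d" for e
    using that
  proof (induction e)
    case 0
    then show ?case
      using assms(2) by (simp add: tt_prod_1)
  next
    case (Suc e)
    have "G (Suc (Suc e)) \<in> tensors (r (Suc e) # [n (Suc (Suc e)), r (Suc (Suc e))])"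
      using assms(3)[of "Suc (Suc e)"] Suc.prems by simp
    from tt_mult_in_tensors[OF Suc.IH this, of "Suc e"] show ?case
      using Suc.prems by (simp add: tt_prod_Suc)
  qed
  \<comment> \<open>The last core has no right bond index, so it lies outside the induction and is
    multiplied on separately.\<close>
  from this[of "d - 2"]
  have "tt_prod (d - 1) r G \<in> tensors (map n [1..<d] @ [r (d - 1)])"
    using assms(1) by (simp add: Suc_diff_Suc numeral_2_eq_2)
  from tt_mult_in_tensors[OF this, of "G d" "[n d]" "d - 1"] show ?thesis
    using assms(1,4) tt_prod_Suc[of "d - 1" r G] by simp
qed

text \<open>Reassociation gathers all cores to the right of position \<open>i\<close> into one
  tensor \<open>R\<close>. For the rank bound only the bond size \<open>r i\<close> at the cut
  matters, so \<open>R\<close> stays existential.\<close>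

lemma tt_prod_split:
  assumes "0 < i" "i < e"
  shows "\<exists>R. \<forall>w. i \<le> length w \<longrightarrow> tt_prod e r G w = tt_mult i (r i) (tt_prod i r G) R w"
  using \<open>i < e\<close>
proof (induction e)
  case (Suc e)
  show ?case
  proof (cases "i = e")
    case True
    then show ?thesis
      using assms(1) by (auto simp: tt_prod_Suc)
  next
    case False
    with Suc obtain R
      where R: "i \<le> length w \<Longrightarrow> tt_prod e r G w = tt_mult i (r i) (tt_prod i r G) R w" for w
      by force
    have "tt_prod (Suc e) r G w
        = tt_mult i (r i) (tt_prod i r G) (tt_mult (Suc e - i) (r e) R (G (Suc e))) w"
      if w: "i \<le> length w" for w
    proof -
      have "tt_prod (Suc e) r G w
          = tt_mult e (r e) (tt_mult i (r i) (tt_prod i r G) R) (G (Suc e)) w"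
        using False Suc.prems w by (simp add: tt_prod_Suc tt_mult_def[of e] R)
      also have "\<dots> = tt_mult i (r i) (tt_prod i r G) (tt_mult (Suc e - i) (r e) R (G (Suc e))) w"
        using False Suc.prems w by (intro tt_mult_assoc) auto
      finally show ?thesis .
    qed
    then show ?thesis
      by blast
  qed
qed simp

text \<open>Each summand is an outer product, hence of rank at most 1, and rank is
  subadditive.\<close>

lemma mat_rank_sum_le:
  fixes f g :: "nat \<Rightarrow> nat \<Rightarrow> real"
  shows "mat_rank (mat nr nc (\<lambda>(a, b). \<Sum>m<r. f m a * g m b)) \<le> r"
proof (induction r)
  case 0
  have "mat nr nc (\<lambda>(a, b). \<Sum>m<0. f m a * g m b) = 0\<^sub>m nr nc"
    by auto
  then show ?case
    by (simp only: mat_rank_def vec_space.rank_0I dim_row_mat index_zero_mat)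
next
  case (Suc r)
  let ?M = "mat nr nc (\<lambda>(a, b). \<Sum>m<r. f m a * g m b)"
  let ?N = "mat nr nc (\<lambda>(a, b). f r a * g r b)"
  have "vec_space.rank nr ?N \<le> 1"
    by (rule vec_space.rank_le_1_product_entries[where f = "f r" and g = "g r" and nc = nc]) auto
  moreover have "vec_space.rank nr (?M + ?N) \<le> vec_space.rank nr ?M + vec_space.rank nr ?N"
    by (rule vec_space.rank_subadditive[where nc = nc]) auto
  moreover have "mat nr nc (\<lambda>(a, b). \<Sum>m<Suc r. f m a * g m b) = ?M + ?N"
    by auto
  ultimately show ?case
    using Suc by (simp add: mat_rank_def)
qed

text \<open>Splitting the product at \<open>i\<close> writes the \<open>i\<close>-th matricization
  as a sum of \<open>r i\<close> outer products.\<close>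

lemma tt_prod_in_TT_variety:
  assumes tens: "tt_prod (length ns) r G \<in> tensors ns"
  shows "tt_prod (length ns) r G \<in> TT_variety ns r"
proof -
  let ?P = "tt_prod (length ns) r G"
  have "mat_rank (matricization ns i ?P) \<le> r i" if i: "i \<in> {1..<length ns}" for i
  proof -
    define R C where "R = tensor_indices (take i ns)" and "C = tensor_indices (drop i ns)"
    obtain Q where Q: "i \<le> length w \<Longrightarrow> ?P w = tt_mult i (r i) (tt_prod i r G) Q w" for w
      using tt_prod_split[of i "length ns" r G] i by auto
    \<comment> \<open>Row words have length exactly \<open>i\<close>, so \<open>take i\<close> and
      \<open>drop i\<close> recover row and column words from their concatenation.\<close>
    have len: "length (R ! a) = i" if "a < length R" for a
      using nth_mem[OF that] i unfolding R_def in_tensor_indices_iff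
      by (auto dest: list_all2_lengthD)
    have "matricization ns i ?P = mat (length R) (length C)
        (\<lambda>(a, b). \<Sum>m<r i. tt_prod i r G (R ! a @ [m]) * Q (m # C ! b))"
      unfolding matricization_def Let_def R_def[symmetric] C_def[symmetric]
      by (intro cong_mat) (auto simp: Q len tt_mult_def)
    then show ?thesis
      by (simp only: mat_rank_sum_le)
  qed
  then show ?thesis
    using tens by (simp add: TT_variety_def)
qed

section \<open>Block tensors\<close>

lemma locate_bounds:
  assumes "a < sum_list rs" "locate rs a = (p, a')"
  shows "p < length rs \<and> a' < rs ! p"
  using assms
proof (induction rs arbitrary: a p a')
  case (Cons b bs)
  show ?case
  proof (cases "a < b")
    case False
    obtain q c where q: "locate bs (a - b) = (q, c)"
      by fastforce
    have "a - b < sum_list bs"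
      using Cons.prems False by simp
    from Cons.IH[OF this q] show ?thesis
      using Cons.prems False q by auto
  qed (use Cons.prems in auto)
qed simp

text \<open>The definition itself cuts off the two outer indices; the middle index is bounded by the
  shape of the block that \<open>locate\<close> selects.\<close>

lemma block_tensor_in_tensors:
  assumes "\<And>p q. p < length rs \<Longrightarrow> q < length cs \<Longrightarrow> Bs ! p ! q \<in> tensors [rs ! p, n, cs ! q]"
  shows "block_tensor rs cs Bs \<in> tensors [sum_list rs, n, sum_list cs]"
proof (rule tensorsI, rule ccontr)
  fix js
  assume js: "\<not> list_all2 (<) js [sum_list rs, n, sum_list cs]" and "block_tensor rs cs Bs js \<noteq> 0"
  then obtain a j b where js': "js = [a, j, b]" and ab: "a < sum_list rs" "b < sum_list cs"
    and nz: "(let (p, a') = locate rs a; (q, b') = locate cs b in (Bs ! p ! q) [a', j, b']) \<noteq> 0"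
    by (auto simp: block_tensor_def split: list.splits if_splits)
  obtain p a' q b' where loc: "locate rs a = (p, a')" "locate cs b = (q, b')"
    by fastforce
  have "Bs ! p ! q \<in> tensors [rs ! p, n, cs ! q]"
    using assms locate_bounds[OF ab(1) loc(1)] locate_bounds[OF ab(2) loc(2)] by blast
  with nz loc have "list_all2 (<) [a', j, b'] [rs ! p, n, cs ! q]"
    by (auto dest: tensorsD)
  with js js' ab show False
    by simp
qed

lemma block_row_in_tensors:
  assumes "\<And>q. q < length cs \<Longrightarrow> Bs ! q \<in> tensors [n, cs ! q]"
  shows "block_row cs Bs \<in> tensors [n, sum_list cs]"
proof (rule tensorsI, rule ccontr)
  fix js
  assume js: "\<not> list_all2 (<) js [n, sum_list cs]" and "block_row cs Bs js \<noteq> 0"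
  then obtain j b where js': "js = [j, b]" and b: "b < sum_list cs"
    and nz: "(let (q, b') = locate cs b in (Bs ! q) [j, b']) \<noteq> 0"
    by (auto simp: block_row_def split: list.splits if_splits)
  obtain q b' where loc: "locate cs b = (q, b')"
    by fastforce
  have "Bs ! q \<in> tensors [n, cs ! q]"
    using assms locate_bounds[OF b loc] by blast
  with nz loc have "list_all2 (<) [j, b'] [n, cs ! q]"
    by (auto dest: tensorsD)
  with js js' b show False
    by simp
qed

lemma block_col_in_tensors:
  assumes "\<And>p. p < length rs \<Longrightarrow> Bs ! p \<in> tensors [rs ! p, n]"
  shows "block_col rs Bs \<in> tensors [sum_list rs, n]"
proof (rule tensorsI, rule ccontr)
  fix js
  assume js: "\<not> list_all2 (<) js [sum_list rs, n]" and "block_col rs Bs js \<noteq> 0"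
  then obtain a j where js': "js = [a, j]" and a: "a < sum_list rs"
    and nz: "(let (p, a') = locate rs a in (Bs ! p) [a', j]) \<noteq> 0"
    by (auto simp: block_col_def split: list.splits if_splits)
  obtain p a' where loc: "locate rs a = (p, a')"
    by fastforce
  have "Bs ! p \<in> tensors [rs ! p, n]"
    using assms locate_bounds[OF a loc] by blast
  with nz loc have "list_all2 (<) [a', j] [rs ! p, n]"
    by (auto dest: tensorsD)
  with js js' a show False
    by simp
qed

section \<open>The curve through the given tensor\<close>

lemma sum_lessThan_add:
  fixes f :: "nat \<Rightarrow> 'a::comm_monoid_add"
  shows "(\<Sum>l<a + b. f l) = (\<Sum>l<a. f l) + (\<Sum>l<b. f (a + l))"
  by (induction b) (simp_all add: add.assoc)

lemma tendsto_fun_iff: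
  fixes x :: "'a \<Rightarrow> 'i \<Rightarrow> 'b::topological_space"
  shows "(x \<longlongrightarrow> l) F \<longleftrightarrow> (\<forall>i. ((\<lambda>m. x m i) \<longlongrightarrow> l i) F)"
  using limitin_componentwise[of "\<lambda>_. euclidean" UNIV x l F]
  by (simp add: euclidean_product_topology)

text \<open>Sampling the curve at t = 1/(m+1) and scaling by m+1 turns the sequence in the cone
  definition into difference quotients at 0.\<close>

lemma tangent_cone_curve:
  fixes f :: "real \<Rightarrow> 'i \<Rightarrow> real"
  assumes mem: "\<And>t. f t \<in> M" and start: "f 0 = A"
    and deriv: "\<And>j. ((\<lambda>t. f t j) has_real_derivative \<xi> j) (at 0)"
  shows "\<xi> \<in> tangent_cone M A"
proof -
  let ?h = "\<lambda>m. inverse (real (Suc m))"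
  have h: "filterlim ?h (at 0) sequentially"
    using LIMSEQ_inverse_real_of_nat by (simp add: filterlim_at)
  have "(\<lambda>m. f (?h m) j) \<longlonglongrightarrow> A j" for j
    using DERIV_isCont[OF deriv[of j]] start h
    by (auto simp: isCont_def intro: filterlim_compose)
  moreover have "(\<lambda>m. real (Suc m) * (f (?h m) j - A j)) \<longlonglongrightarrow> \<xi> j" for j
    using filterlim_compose[OF deriv[of j, unfolded DERIV_def] h] start
    by (simp add: divide_inverse mult.commute)
  ultimately show ?thesis
    unfolding tangent_cone_def tendsto_fun_iff
    by (intro CollectI exI[of _ "\<lambda>m. f (?h m)"] exI[of _ "\<lambda>m. real (Suc m)"]) (simp add: mem)
qed

lemma tt_mult_append:
  "length js = p \<Longrightarrow> tt_mult p r A B (js @ w) = (\<Sum>m<r. A (js @ [m]) * B (m # w))"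
  by (simp add: tt_mult_def)

text \<open>
  The product rule at 0 for one contraction along the curve: of the two blocks of sizes
  \<open>k\<close> and \<open>s\<close> only the first carries a first-order term, and its derivative is stored in the third
  block (offset \<open>k + s\<close>) of the contraction describing the tangent vector.
\<close>

lemma DERIV_block_contraction:
  fixes p :: "real \<Rightarrow> nat \<Rightarrow> real"
  assumes p: "\<And>l. l < k \<Longrightarrow> ((\<lambda>t. p t l) has_real_derivative q (k + s + l)) (at 0)"
      "\<And>l. l < k \<Longrightarrow> p 0 l = q l"
      "\<And>l. l < s \<Longrightarrow> (\<lambda>t. p t (k + l)) differentiable at 0"
      "\<And>l. l < s \<Longrightarrow> p 0 (k + l) = q (k + l)"
    and g: "\<And>t l. l < k \<Longrightarrow> g t l = a l + t * x l" "\<And>t l. l < s \<Longrightarrow> g t (k + l) = t * v l"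
    and h: "\<And>l. l < k \<Longrightarrow> h l = x l" "\<And>l. l < s \<Longrightarrow> h (k + l) = v l"
      "\<And>l. l < k \<Longrightarrow> h (k + s + l) = a l"
  shows "((\<lambda>t. \<Sum>l<k + s. p t l * g t l) has_real_derivative (\<Sum>l<k + s + k. q l * h l)) (at 0)"
proof -
  \<comment> \<open>The value of \<open>D\<close> is irrelevant: its term in the product rule
    carries the factor \<open>t\<close>, which vanishes at 0.\<close>
  obtain D where D: "\<And>l. l < s \<Longrightarrow> ((\<lambda>t. p t (k + l)) has_real_derivative D l) (at 0)"
    using p(3) unfolding real_differentiable_def by metis
  have "((\<lambda>t. \<Sum>l<k. p t l * (a l + t * x l)) has_real_derivative
      (\<Sum>l<k. q (k + s + l) * a l + q l * x l)) (at 0)"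
    by (intro DERIV_sum) (auto intro!: derivative_eq_intros p(1) simp: p(2))
  moreover have "((\<lambda>t. \<Sum>l<s. p t (k + l) * (t * v l)) has_real_derivative
      (\<Sum>l<s. q (k + l) * v l)) (at 0)"
    by (intro DERIV_sum) (auto intro!: derivative_eq_intros D simp: p(4))
  ultimately have "((\<lambda>t. (\<Sum>l<k. p t l * (a l + t * x l)) + (\<Sum>l<s. p t (k + l) * (t * v l)))
      has_real_derivative (\<Sum>l<k. q (k + s + l) * a l + q l * x l) + (\<Sum>l<s. q (k + l) * v l)) (at 0)"
    by (rule DERIV_add)
  moreover have "(\<Sum>l<k + s + k. q l * h l)
      = (\<Sum>l<k. q (k + s + l) * a l + q l * x l) + (\<Sum>l<s. q (k + l) * v l)"
    by (simp add: sum_lessThan_add h sum.distrib)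
  ultimately show ?thesis
    by (simp add: sum_lessThan_add g)
qed

theorem lemma12:
  fixes d :: nat
    and n k s :: "nat \<Rightarrow> nat"
    and T \<X> :: tensor
    and A U X Z V :: "nat \<Rightarrow> tensor"
  assumes "2 \<le> d"
    and "\<forall>i\<in>{1..d}. 0 < n i"
    and "T \<in> TT_manifold (map n [1..<Suc d]) k"
    and "A 1 \<in> tensors [n 1, k 1]"
    and "\<forall>i\<in>{2..<d}. A i \<in> tensors [k (i - 1), n i, k i]"
    and "A d \<in> tensors [k (d - 1), n d]"
    and "T = tt_prod d k A"
    and "U 1 \<in> tensors [n 1, s 1]"
    and "X 1 \<in> tensors [n 1, k 1]"
    and "\<forall>i\<in>{2..<d}. U i \<in> tensors [k (i - 1), n i, s i]"
    and "\<forall>i\<in>{2..<d}. X i \<in> tensors [k (i - 1), n i, k i]"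
    and "\<forall>i\<in>{2..<d}. Z i \<in> tensors [s (i - 1), n i, s i]"
    and "\<forall>i\<in>{2..<d}. V i \<in> tensors [s (i - 1), n i, k i]"
    and "X d \<in> tensors [k (d - 1), n d]"
    and "V d \<in> tensors [s (d - 1), n d]"
    and "\<X> \<in> tensors (map n [1..<Suc d])"
    and "\<X> = tt_prod d (\<lambda>i. k i + s i + k i)
          (\<lambda>i. if i = 1 then block_row [k 1, s 1, k 1] [A 1, U 1, X 1]
               else if i = d then
                 block_col [k (d - 1), s (d - 1), k (d - 1)] [X d, V d, A d]
               else
                 block_tensor [k (i - 1), s (i - 1), k (i - 1)] [k i, s i, k i]
                   [[A i,         U i,         X i],
                    [zero_tensor, Z i,         V i],
                    [zero_tensor, zero_tensor, A i]])"
  shows "\<X> \<in> tangent_cone (TT_variety (map n [1..<Suc d]) (\<lambda>i. k i + s i)) T"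
proof -
  define G where "G t i =
    (if i = 1 then block_row [k 1, s 1] [\<lambda>js. A 1 js + t * X 1 js, U 1]
     else if i = d then
       block_col [k (d - 1), s (d - 1)] [\<lambda>js. A d js + t * X d js, \<lambda>js. t * V d js]
     else block_tensor [k (i - 1), s (i - 1)] [k i, s i]
       [[\<lambda>js. A i js + t * X i js, U i], [\<lambda>js. t * V i js, Z i]])" for t i
  define H where "H i =
    (if i = 1 then block_row [k 1, s 1, k 1] [A 1, U 1, X 1]
     else if i = d then block_col [k (d - 1), s (d - 1), k (d - 1)] [X d, V d, A d]
     else block_tensor [k (i - 1), s (i - 1), k (i - 1)] [k i, s i, k i]
       [[A i, U i, X i], [zero_tensor, Z i, V i], [zero_tensor, zero_tensor, A i]])" for i
  define r where "r i = k i + s i" for i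
  \<comment> \<open>The left partial products of the curve, of the given factorization and of the
    \<open>A i\<close> are compared core by core.\<close>
  define P where "P t e = tt_prod e r (G t)" for t e
  define Q where "Q e = tt_prod e (\<lambda>i. k i + s i + k i) H" for e
  define S where "S e = tt_prod e k A" for e
  note blocks = G_def H_def block_tensor_def block_row_def block_col_def zero_tensor_def

  \<comment> \<open>The shapes of the cores alone bound the ranks, so this holds for every real
    \<open>t\<close>.\<close>
  have mem: "P t d \<in> TT_variety (map n [1..<Suc d]) r" for t
  proof -
    have "block_row [k 1, s 1] [\<lambda>js. A 1 js + t * X 1 js, U 1] \<in> tensors [n 1, sum_list [k 1, s 1]]"
      using assms(4,8,9)
      by (intro block_row_in_tensors) (auto simp: less_Suc_eq tensors_lincomb)
    then have 1: "G t 1 \<in> tensors [n 1, r 1]"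
      by (simp add: G_def r_def)
    have "block_col [k (d - 1), s (d - 1)] [\<lambda>js. A d js + t * X d js, \<lambda>js. t * V d js]
        \<in> tensors [sum_list [k (d - 1), s (d - 1)], n d]"
      using assms(6,14,15)
      by (intro block_col_in_tensors) (auto simp: less_Suc_eq tensors_lincomb tensors_scale)
    then have d: "G t d \<in> tensors [r (d - 1), n d]"
      using assms(1) by (simp add: G_def r_def)
    have i: "G t i \<in> tensors [r (i - 1), n i, r i]" if i: "i \<in> {2..<d}" for i
    proof -
      have "block_tensor [k (i - 1), s (i - 1)] [k i, s i]
          [[\<lambda>js. A i js + t * X i js, U i], [\<lambda>js. t * V i js, Z i]]
          \<in> tensors [sum_list [k (i - 1), s (i - 1)], n i, sum_list [k i, s i]]"
        using bspec[OF assms(5) i] bspec[OF assms(10) i] bspec[OF assms(11) i]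
          bspec[OF assms(12) i] bspec[OF assms(13) i]
        by (intro block_tensor_in_tensors) (auto simp: less_Suc_eq tensors_lincomb tensors_scale)
      then show ?thesis
        using i by (simp add: G_def r_def)
    qed
    have "P t d \<in> tensors (map n [1..<Suc d])"
      unfolding P_def using tt_prod_in_tensors[OF assms(1), of "G t" n r] 1 i d by blast
    then show ?thesis
      using tt_prod_in_TT_variety[of "map n [1..<Suc d]" r "G t"] assms(1) by (simp add: P_def)
  qed

  \<comment> \<open>The last index runs through the block columns. In the first one, the curve
    starts at the product of the \<open>A i\<close>, and its derivative is the third block of
    \<open>Q\<close>. In the second one, values at 0 and differentiability suffice, since a later
    block \<open>t V\<close> supplies the factor \<open>t\<close>.\<close>
  have inv: "(\<forall>b<k (Suc e).
        ((\<lambda>t. P t (Suc e) (js @ [b])) has_real_derivative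
           Q (Suc e) (js @ [k (Suc e) + s (Suc e) + b])) (at 0) \<and>
        P 0 (Suc e) (js @ [b]) = Q (Suc e) (js @ [b]) \<and>
        Q (Suc e) (js @ [b]) = S (Suc e) (js @ [b])) \<and>
      (\<forall>b<s (Suc e).
        (\<lambda>t. P t (Suc e) (js @ [k (Suc e) + b])) differentiable at 0 \<and>
        P 0 (Suc e) (js @ [k (Suc e) + b]) = Q (Suc e) (js @ [k (Suc e) + b]))"
    if "Suc e < d" "length js = Suc e" for e js
    using that
  proof (induction e arbitrary: js)
    case 0
    then obtain j where js: "js = [j]"
      by (auto simp: length_Suc_conv)
    show ?case
      by (auto simp: js P_def Q_def S_def tt_prod_1 blocks
          intro!: derivative_eq_intros)
  next
    case (Suc e)
    let ?e = "Suc e" and ?i = "Suc (Suc e)"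
    obtain ks j where js: "js = ks @ [j]" and ks: "length ks = ?e"
      using Suc.prems(2) by (metis length_Suc_conv_rev)
    note IH = Suc.IH[OF _ ks]
    have P: "P t ?i (js @ w) = (\<Sum>l<k ?e + s ?e. P t ?e (ks @ [l]) * G t ?i (l # j # w))" for t w
      using ks by (simp add: P_def tt_prod_Suc js tt_mult_append r_def)
    have Q: "Q ?i (js @ w) = (\<Sum>l<k ?e + s ?e + k ?e. Q ?e (ks @ [l]) * H ?i (l # j # w))" for w
      using ks by (simp add: Q_def tt_prod_Suc js tt_mult_append)
    have S: "S ?i (js @ w) = (\<Sum>l<k ?e. S ?e (ks @ [l]) * A ?i (l # j # w))" for w
      using ks by (simp add: S_def tt_prod_Suc js tt_mult_append)
    have diff: "(\<lambda>t. P t ?e (ks @ [l])) differentiable at 0" if "l < k ?e + s ?e" for l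
    proof (cases "l < k ?e")
      case False
      then have "l = k ?e + (l - k ?e)" "l - k ?e < s ?e"
        using that by auto
      then show ?thesis
        using IH Suc.prems(1) by (metis Suc_lessD)
    qed (use IH Suc.prems(1) in \<open>auto simp: real_differentiable_def\<close>)
    show ?case
    proof (intro conjI allI impI)
      fix b assume b: "b < k ?i"
      \<comment> \<open>The first block column of \<open>G t\<close> is (A + tX, tV) and the third
        one of \<open>H\<close> is (X, V, A), as the contraction rule requires.\<close>
      show "((\<lambda>t. P t ?i (js @ [b])) has_real_derivative Q ?i (js @ [k ?i + s ?i + b])) (at 0)"
        unfolding P Q
        by (rule DERIV_block_contraction[where a = "\<lambda>l. A ?i [l, j, b]"
              and x = "\<lambda>l. X ?i [l, j, b]" and v = "\<lambda>l. V ?i [l, j, b]"])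
          (use IH Suc.prems b in \<open>auto simp: blocks\<close>)
      \<comment> \<open>At t = 0 the block \<open>t V\<close> vanishes, and the first block column
        of \<open>H\<close> is (A, 0, 0), so only the first block contributes on either
        side.\<close>
      show "P 0 ?i (js @ [b]) = Q ?i (js @ [b])"
        unfolding P Q using IH Suc.prems b by (simp add: sum_lessThan_add blocks)
      show "Q ?i (js @ [b]) = S ?i (js @ [b])"
        unfolding Q S using IH Suc.prems b by (simp add: sum_lessThan_add blocks)
    next
      fix b assume b: "b < s ?i"
      show "P 0 ?i (js @ [k ?i + b]) = Q ?i (js @ [k ?i + b])"
        unfolding P Q using IH Suc.prems b by (simp add: sum_lessThan_add blocks)
      \<comment> \<open>The second block column (U, Z) is constant in \<open>t\<close>, so
        differentiability passes on from the previous partial product.\<close>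
      have G: "G t ?i [l, j, k ?i + b] = (if l < k ?e then U ?i [l, j, b] else Z ?i [l - k ?e, j, b])"
        if "l < k ?e + s ?e" for t l
        using Suc.prems b that by (auto simp: blocks)
      show "(\<lambda>t. P t ?i (js @ [k ?i + b])) differentiable at 0"
        unfolding P by (intro differentiable_sum differentiable_mult) (auto simp: G diff)
    qed
  qed

  \<comment> \<open>With this \<open>e\<close>, \<open>inv\<close> describes the product of the
    first \<open>d - 1\<close> cores, to which only the last core is still to be attached.\<close>
  define e where "e = d - 2"
  have d: "d = Suc (Suc e)"
    using assms(1) by (simp add: e_def)
  have \<X>: "\<X> = Q d"
    unfolding assms(17) Q_def H_def ..
  \<comment> \<open>The closing column (X, V, A) acts like the third block column of an inner core,
    so the full product \<open>Q d\<close> is itself the derivative.\<close>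
  have last: "((\<lambda>t. P t d w) has_real_derivative Q d w) (at 0) \<and> P 0 d w = S d w"
    if w: "length w = d" for w
  proof -
    obtain ks j where js: "w = ks @ [j]" and ks: "length ks = Suc e"
      using w d by (metis length_Suc_conv_rev)
    note I = inv[OF _ ks]
    have P: "P t d w = (\<Sum>l<k (Suc e) + s (Suc e). P t (Suc e) (ks @ [l]) * G t d [l, j])" for t
      using ks by (simp add: P_def d tt_prod_Suc js tt_mult_append r_def)
    have Q: "Q d w = (\<Sum>l<k (Suc e) + s (Suc e) + k (Suc e). Q (Suc e) (ks @ [l]) * H d [l, j])"
      using ks by (simp add: Q_def d tt_prod_Suc js tt_mult_append)
    have S: "S d w = (\<Sum>l<k (Suc e). S (Suc e) (ks @ [l]) * A d [l, j])"
      using ks by (simp add: S_def d tt_prod_Suc js tt_mult_append)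
    have "((\<lambda>t. P t d w) has_real_derivative Q d w) (at 0)"
      unfolding P Q
      by (rule DERIV_block_contraction[where a = "\<lambda>l. A d [l, j]"
              and x = "\<lambda>l. X d [l, j]" and v = "\<lambda>l. V d [l, j]"])
        (use I d in \<open>auto simp: blocks\<close>)
    moreover have "P 0 d w = S d w"
      unfolding P S using I d by (simp add: sum_lessThan_add blocks)
    ultimately show ?thesis
      by simp
  qed

  \<comment> \<open>\<open>last\<close> covers only words of length \<open>d\<close>; on all other
    words the tensors involved are 0 by convention.\<close>
  have outside: "B w = 0" if "B \<in> tensors (map n [1..<Suc d])" "length w \<noteq> d" for B w
    using that list_all2_lengthD[of "(<)" w "map n [1..<Suc d]"] by (intro tensorsD[OF that(1)]) auto
  have T: "T = S d" and T_tens: "T \<in> tensors (map n [1..<Suc d])"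
    using assms(3,7) by (auto simp: S_def TT_manifold_def)
  have P_tens: "P t d \<in> tensors (map n [1..<Suc d])" for t
    using mem by (simp add: TT_variety_def)
  have "P 0 d = T"
  proof
    fix w show "P 0 d w = T w"
      using last outside[OF P_tens] outside[OF T_tens] T by (cases "length w = d") auto
  qed
  moreover have "((\<lambda>t. P t d w) has_real_derivative \<X> w) (at 0)" for w
    using last outside[OF P_tens] outside[OF assms(16)] \<X> by (cases "length w = d") auto
  ultimately show ?thesis
    using tangent_cone_curve[of "\<lambda>t. P t d", OF mem] unfolding r_def by blast
qed

end
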